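(* Let $F$ be a field of characteristic zero and let $(A,\{\,,\})$ be a simple Poisson algebra over $F$ with $1\in A$. Let $Z=\{a\in A \mid \{a,A\}=(0)\}$. Then the Lie algebra $\{A,A\}/(\{A,A\}\cap Z)$ is simple.
   Context: A Poisson algebra over a field $F$ is an associative commutative $F$-algebra $A$ with a bilinear bracket $\{\,,\}:A\times A\to A$ (a Poisson bracket) such that (1) $(A,\{\,,\})$ is a Lie algebra, and (2) $\{ab,c\}=a\{b,c\}+\{a,c\}b$ for all $a,b,c\in A$. An ideal $I$ of the associative algebra $A$ is a Poisson ideal if $\{I,A\}\subseteq I$. A Poisson algebra without nontrivial Poisson ideals (i.e. with no Poisson ideals other than $(0)$ and $A$) is called simple. For subspaces $X,Y\subseteq A$, $\{X,Y\}$ denotes the linear span of all $\{x,y\}$, $x\in X$, $y\in Y$; $\{A,A\}$ is regarded as a Lie algebra under $\{\,,\}$. *)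

theory Defs
  imports Complex_Main
begin

record ('f, 'l) lie_struct =
  carrier :: "'l set"
  zero :: 'l
  add :: "'l \<Rightarrow> 'l \<Rightarrow> 'l"
  smult :: "'f \<Rightarrow> 'l \<Rightarrow> 'l"
  brk :: "'l \<Rightarrow> 'l \<Rightarrow> 'l"

locale lie_algebra =
  fixes L :: "('f::field, 'l) lie_struct"
  assumes zero_closed: "zero L \<in> carrier L"
    and add_closed: "\<lbrakk>x \<in> carrier L; y \<in> carrier L\<rbrakk> \<Longrightarrow> add L x y \<in> carrier L"
    and smult_closed: "x \<in> carrier L \<Longrightarrow> smult L c x \<in> carrier L"
    and brk_closed: "\<lbrakk>x \<in> carrier L; y \<in> carrier L\<rbrakk> \<Longrightarrow> brk L x y \<in> carrier L"
    and add_assoc: "\<lbrakk>x \<in> carrier L; y \<in> carrier L; z \<in> carrier L\<rbrakk>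
      \<Longrightarrow> add L (add L x y) z = add L x (add L y z)"
    and add_comm: "\<lbrakk>x \<in> carrier L; y \<in> carrier L\<rbrakk> \<Longrightarrow> add L x y = add L y x"
    and add_zero: "x \<in> carrier L \<Longrightarrow> add L (zero L) x = x"
    and add_inverse: "x \<in> carrier L \<Longrightarrow> \<exists>y\<in>carrier L. add L x y = zero L"
    and smult_add: "\<lbrakk>x \<in> carrier L; y \<in> carrier L\<rbrakk>
      \<Longrightarrow> smult L c (add L x y) = add L (smult L c x) (smult L c y)"
    and add_smult: "x \<in> carrier L \<Longrightarrow> smult L (c + d) x = add L (smult L c x) (smult L d x)"
    and smult_smult: "x \<in> carrier L \<Longrightarrow> smult L c (smult L d x) = smult L (c * d) x"
    and smult_one: "x \<in> carrier L \<Longrightarrow> smult L 1 x = x"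
    and brk_add_left: "\<lbrakk>x \<in> carrier L; y \<in> carrier L; z \<in> carrier L\<rbrakk>
      \<Longrightarrow> brk L (add L x y) z = add L (brk L x z) (brk L y z)"
    and brk_add_right: "\<lbrakk>x \<in> carrier L; y \<in> carrier L; z \<in> carrier L\<rbrakk>
      \<Longrightarrow> brk L x (add L y z) = add L (brk L x y) (brk L x z)"
    and brk_smult_left: "\<lbrakk>x \<in> carrier L; y \<in> carrier L\<rbrakk>
      \<Longrightarrow> brk L (smult L c x) y = smult L c (brk L x y)"
    and brk_smult_right: "\<lbrakk>x \<in> carrier L; y \<in> carrier L\<rbrakk>
      \<Longrightarrow> brk L x (smult L c y) = smult L c (brk L x y)"
    and brk_alternating: "x \<in> carrier L \<Longrightarrow> brk L x x = zero L"
    and jacobi: "\<lbrakk>x \<in> carrier L; y \<in> carrier L; z \<in> carrier L\<rbrakk>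
      \<Longrightarrow> add L (brk L x (brk L y z)) (add L (brk L y (brk L z x)) (brk L z (brk L x y))) = zero L"

definition lie_ideal :: "('f, 'l) lie_struct \<Rightarrow> 'l set \<Rightarrow> bool" where
  "lie_ideal L I \<longleftrightarrow> I \<subseteq> carrier L \<and> zero L \<in> I
     \<and> (\<forall>x\<in>I. \<forall>y\<in>I. add L x y \<in> I) \<and> (\<forall>c. \<forall>x\<in>I. smult L c x \<in> I)
     \<and> (\<forall>x\<in>I. \<forall>y\<in>carrier L. brk L x y \<in> I)"

definition lie_abelian :: "('f, 'l) lie_struct \<Rightarrow> bool" where
  "lie_abelian L \<longleftrightarrow> (\<forall>x\<in>carrier L. \<forall>y\<in>carrier L. brk L x y = zero L)"

text \<open>
  As for Poisson algebras below, simple means having no ideals besides zero and the whole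
  algebra; being nonabelian is not part of the definition.
\<close>

definition simple_lie_algebra :: "('f::field, 'l) lie_struct \<Rightarrow> bool" where
  "simple_lie_algebra L \<longleftrightarrow>
     lie_algebra L \<and> (\<forall>I. lie_ideal L I \<longrightarrow> I = {zero L} \<or> I = carrier L)"

text \<open>The operations on cosets are the images of the cosets' elements, enlarged by \<open>N\<close>.\<close>

definition lie_quotient :: "('f, 'l) lie_struct \<Rightarrow> 'l set \<Rightarrow> ('f, 'l set) lie_struct" where
  "lie_quotient L N =
     \<lparr>carrier = {add L x ` N | x. x \<in> carrier L},
      zero = N,
      add = (\<lambda>X Y. \<Union>x\<in>X. \<Union>y\<in>Y. add L (add L x y) ` N),
      smult = (\<lambda>c X. \<Union>x\<in>X. add L (smult L c x) ` N),
      brk = (\<lambda>X Y. \<Union>x\<in>X. \<Union>y\<in>Y. add L (brk L x y) ` N)\<rparr>"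

text \<open>The Lie structure induced on a subset \<open>S\<close> of a type carrying a scaling and a bracket.\<close>

definition lie_on ::
  "('f \<Rightarrow> 'a::ab_group_add \<Rightarrow> 'a) \<Rightarrow> ('a \<Rightarrow> 'a \<Rightarrow> 'a) \<Rightarrow> 'a set \<Rightarrow> ('f, 'a) lie_struct" where
  "lie_on scale bracket S =
     \<lparr>carrier = S, zero = 0, add = (+), smult = scale, brk = bracket\<rparr>"

locale poisson_algebra = vector_space scale
  for scale :: "'f::field \<Rightarrow> 'a::comm_ring \<Rightarrow> 'a" +
  fixes bracket :: "'a \<Rightarrow> 'a \<Rightarrow> 'a"
  assumes scale_mult: "scale k (a * b) = scale k a * b"
    and lie: "lie_algebra (lie_on scale bracket UNIV)"
    and leibniz: "bracket (a * b) c = a * bracket b c + bracket a c * b"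

definition bracket_span ::
  "('f::field \<Rightarrow> 'a::ab_group_add \<Rightarrow> 'a) \<Rightarrow> ('a \<Rightarrow> 'a \<Rightarrow> 'a) \<Rightarrow> 'a set \<Rightarrow> 'a set \<Rightarrow> 'a set" where
  "bracket_span scale bracket X Y = module.span scale {bracket x y | x y. x \<in> X \<and> y \<in> Y}"

definition poisson_ideal ::
  "('f::field \<Rightarrow> 'a::comm_ring \<Rightarrow> 'a) \<Rightarrow> ('a \<Rightarrow> 'a \<Rightarrow> 'a) \<Rightarrow> 'a set \<Rightarrow> bool" where
  "poisson_ideal scale bracket I \<longleftrightarrow>
     module.subspace scale I \<and> (\<forall>a. \<forall>x\<in>I. a * x \<in> I)
     \<and> bracket_span scale bracket I UNIV \<subseteq> I"

definition simple_poisson_algebra ::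
  "('f::field \<Rightarrow> 'a::comm_ring \<Rightarrow> 'a) \<Rightarrow> ('a \<Rightarrow> 'a \<Rightarrow> 'a) \<Rightarrow> bool" where
  "simple_poisson_algebra scale bracket \<longleftrightarrow>
     poisson_algebra scale bracket
     \<and> (\<forall>I. poisson_ideal scale bracket I \<longrightarrow> I = {0} \<or> I = UNIV)"

definition poisson_center :: "('a \<Rightarrow> 'a \<Rightarrow> 'a::zero) \<Rightarrow> 'a set" where
  "poisson_center bracket = {a. \<forall>x. bracket a x = 0}"

end

(* For a Lie ideal I of U = {A, A}, let M = {t. {t, A} <= I}. By the identity
   {tu, x} = {t, ux} + {u, xt}, M is a subalgebra; it is U-stable and contains {I, I}.
   The largest ideal K of A inside M is U-stable, and U-stable proper ideals of A vanish.
   If K = A, then U = {A, A} <= I. If K = 0, then {t, M} = 0 whenever {t, A} <= M, since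
   {t, u}x = {t, ux} - u{t, x}. As A is reduced of characteristic zero, a nilpotent inner
   derivation is zero; this makes {M, I}, then M, then I central. *)

theory Submission
  imports Defs
begin

section \<open>Ideals and radicals\<close>

definition ring_ideal :: "'a::comm_ring_1 set \<Rightarrow> bool" where
  "ring_ideal K \<longleftrightarrow> 0 \<in> K \<and> (\<forall>x\<in>K. \<forall>y\<in>K. x + y \<in> K) \<and> (\<forall>a. \<forall>x\<in>K. a * x \<in> K)"

text \<open>The exponent 0 does no harm: for an ideal, \<open>x ^ 0 \<in> K\<close> means that
  \<open>K\<close> is everything, so this is the usual radical.\<close>

definition ring_radical :: "'a::comm_ring_1 set \<Rightarrow> 'a set" where
  "ring_radical K = {x. \<exists>n. x ^ n \<in> K}"

lemma ring_idealD:
  assumes "ring_ideal K"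
  shows "0 \<in> K" "\<lbrakk>x \<in> K; y \<in> K\<rbrakk> \<Longrightarrow> x + y \<in> K" "x \<in> K \<Longrightarrow> a * x \<in> K" "x \<in> K \<Longrightarrow> x * a \<in> K"
    "\<lbrakk>x \<in> K; y \<in> K\<rbrakk> \<Longrightarrow> x - y \<in> K"
proof -
  show "0 \<in> K" using assms by (simp add: ring_ideal_def)
  show add: "\<lbrakk>x \<in> K; y \<in> K\<rbrakk> \<Longrightarrow> x + y \<in> K" for x y
    using assms by (simp add: ring_ideal_def)
  show mult: "x \<in> K \<Longrightarrow> a * x \<in> K" for a x
    using assms by (simp add: ring_ideal_def)
  show "x \<in> K \<Longrightarrow> x * a \<in> K" using mult[of x a] by (simp add: mult.commute)
  show "\<lbrakk>x \<in> K; y \<in> K\<rbrakk> \<Longrightarrow> x - y \<in> K" using add[of x "-1 * y"] mult[of y "-1"] by simp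
qed

lemma ring_ideal_sum:
  assumes "ring_ideal K" "\<And>i. i \<in> S \<Longrightarrow> f i \<in> K"
  shows "sum f S \<in> K"
  using assms(2) by (induction S rule: infinite_finite_induct) (auto intro: ring_idealD[OF assms(1)])

lemma ring_ideal_power_mono:
  assumes "ring_ideal K" "x ^ n \<in> K" "n \<le> m"
  shows "x ^ m \<in> K"
  using ring_idealD(3)[OF assms(1,2), of "x ^ (m - n)"] assms(3) by (simp flip: power_add)

lemma ring_radical_superset: "K \<subseteq> ring_radical K"
  unfolding ring_radical_def by (auto intro: exI[of _ 1])

lemma one_in_ring_radical_iff: "1 \<in> ring_radical K \<longleftrightarrow> 1 \<in> K"
  by (simp add: ring_radical_def)

lemma ring_radical_power:
  assumes "x ^ n \<in> ring_radical K"
  shows "x \<in> ring_radical K"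
  using assms by (auto simp: ring_radical_def simp flip: power_mult)

lemma ring_ideal_radical:
  assumes K: "ring_ideal K"
  shows "ring_ideal (ring_radical K)"
  unfolding ring_ideal_def
proof (intro conjI ballI allI)
  show "0 \<in> ring_radical K"
    using ring_idealD(1)[OF K] ring_radical_superset by blast
next
  fix x y assume "x \<in> ring_radical K" "y \<in> ring_radical K"
  then obtain m n where m: "x ^ m \<in> K" and n: "y ^ n \<in> K"
    by (auto simp: ring_radical_def)
  \<comment> \<open>In each binomial term either \<open>x\<close> has exponent at least
    \<open>m\<close> or \<open>y\<close> has exponent at least \<open>n\<close>.\<close>
  have "of_nat (m + n choose k) * x ^ k * y ^ (m + n - k) \<in> K" if "k \<le> m + n" for k
  proof (cases "m \<le> k")
    case True
    then show ?thesis
      using ring_ideal_power_mono[OF K m True] ring_idealD(3,4)[OF K] by blast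
  next
    case False
    then have "n \<le> m + n - k" by simp
    then show ?thesis
      using ring_ideal_power_mono[OF K n] ring_idealD(3)[OF K] by blast
  qed
  then have "(x + y) ^ (m + n) \<in> K"
    unfolding binomial_ring by (intro ring_ideal_sum[OF K]) simp
  then show "x + y \<in> ring_radical K"
    by (auto simp: ring_radical_def)
next
  fix a x assume "x \<in> ring_radical K"
  then show "a * x \<in> ring_radical K"
    using ring_idealD(3)[OF K] by (auto simp: ring_radical_def power_mult_distrib)
qed

section \<open>Poisson algebras\<close>

context poisson_algebra
begin

abbreviation "U \<equiv> bracket_span scale bracket UNIV UNIV"

lemma bracket_add_left: "bracket (x + y) z = bracket x z + bracket y z"
  using lie_algebra.brk_add_left[OF lie] by (simp add: lie_on_def)

lemma bracket_add_right: "bracket x (y + z) = bracket x y + bracket x z"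
  using lie_algebra.brk_add_right[OF lie] by (simp add: lie_on_def)

lemma bracket_scale_left: "bracket (scale c x) y = scale c (bracket x y)"
  using lie_algebra.brk_smult_left[OF lie] by (simp add: lie_on_def)

lemma bracket_scale_right: "bracket x (scale c y) = scale c (bracket x y)"
  using lie_algebra.brk_smult_right[OF lie] by (simp add: lie_on_def)

lemma bracket_self: "bracket x x = 0"
  using lie_algebra.brk_alternating[OF lie] by (simp add: lie_on_def)

lemma jacobi_identity: "bracket x (bracket y z) + (bracket y (bracket z x) + bracket z (bracket x y)) = 0"
  using lie_algebra.jacobi[OF lie] by (simp add: lie_on_def)

lemma bracket_anticomm: "bracket x y = - bracket y x"
proof -
  have "bracket x y + bracket y x = bracket (x + y) (x + y)"
    unfolding bracket_add_left bracket_add_right by (simp add: bracket_self)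
  also have "\<dots> = 0" by (rule bracket_self)
  finally show ?thesis by (rule eq_neg_iff_add_eq_0[THEN iffD2])
qed

lemma bracket_zero_left [simp]: "bracket 0 x = 0"
  using bracket_add_left[of 0 0 x] by simp

lemma bracket_zero_right [simp]: "bracket x 0 = 0"
  using bracket_add_right[of x 0 0] by simp

lemma leibniz_right: "bracket c (a * b) = a * bracket c b + bracket c a * b"
proof -
  have "bracket c (a * b) = - (a * bracket b c + bracket a c * b)"
    by (simp add: bracket_anticomm[of c] leibniz)
  also have "\<dots> = a * (- bracket b c) + (- bracket a c) * b" by simp
  finally show ?thesis by (simp only: bracket_anticomm[of c, symmetric])
qed

text \<open>The Jacobi identity says that bracketing with \<open>z\<close> on the right is a
  derivation of the bracket. This form decides whether a bracket lies in a set defined by a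
  condition on \<open>{t, A}\<close>.\<close>

lemma jacobi_derivation: "bracket (bracket x y) z = bracket (bracket x z) y + bracket x (bracket y z)"
proof -
  have "bracket (bracket x z) y = bracket y (bracket z x)"
    using bracket_anticomm[of "bracket x z" y] bracket_anticomm[of x z]
      bracket_scale_right[of y "-1" "bracket z x"] by simp
  moreover have "bracket z (bracket x y) = - bracket (bracket x y) z"
    by (rule bracket_anticomm)
  ultimately show ?thesis
    using jacobi_identity[of x y z] by (simp add: add_diff_eq add.commute)
qed

lemma subspace_U: "subspace U"
  by (simp add: bracket_span_def subspace_span)

lemma bracket_in_U [simp, intro]: "bracket x y \<in> U"
  unfolding bracket_span_def by (rule span_base) blast

lemma subspace_bracket_swap:
  assumes "subspace I" "bracket x y \<in> I"
  shows "bracket y x \<in> I"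
  using subspace_neg[OF assms] by (simp flip: bracket_anticomm)

lemma bracket_eq_0_swap: "bracket x y = 0 \<Longrightarrow> bracket y x = 0"
  by (subst bracket_anticomm) simp

lemma lie_algebra_on:
  assumes S: "subspace S" and "\<And>x y. \<lbrakk>x \<in> S; y \<in> S\<rbrakk> \<Longrightarrow> bracket x y \<in> S"
  shows "lie_algebra (lie_on scale bracket S)"
proof
  fix x assume "x \<in> carrier (lie_on scale bracket S)"
  then show "\<exists>y\<in>carrier (lie_on scale bracket S).
      add (lie_on scale bracket S) x y = zero (lie_on scale bracket S)"
    using subspace_neg[OF S] by (auto simp: lie_on_def intro!: bexI[of _ "- x"])
qed (use assms in \<open>auto simp: lie_on_def subspace_0 subspace_add subspace_scale
    bracket_add_left bracket_add_right bracket_scale_left bracket_scale_right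
    bracket_self jacobi_identity scale_right_distrib scale_left_distrib\<close>)

lemma U_minimal:
  assumes "subspace I" "\<And>x y. bracket x y \<in> I"
  shows "U \<subseteq> I"
  unfolding bracket_span_def using assms by (intro span_minimal) auto

end

section \<open>Simple Poisson algebras in characteristic zero\<close>

locale unital_simple_poisson_algebra = poisson_algebra scale bracket
  for scale :: "'f::field_char_0 \<Rightarrow> 'a::comm_ring_1 \<Rightarrow> 'a" and bracket +
  assumes simple: "poisson_ideal scale bracket I \<Longrightarrow> I = {0} \<or> I = UNIV"
begin

lemma scale_eq_mult: "scale c x = scale c 1 * x"
  using scale_mult[of c 1 x] by simp

lemma of_nat_scale: "scale (of_nat n) x = of_nat n * x"
  by (induction n) (simp_all add: scale_left_distrib distrib_right)

text \<open>Characteristic zero enters here: \<open>of_nat n\<close> is inverted by multiplying with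
  \<open>scale (1 / of_nat n) 1\<close>.\<close>

lemma ring_ideal_divide_of_nat:
  fixes K :: "'a set"
  assumes "ring_ideal K" "of_nat n * x \<in> K" "n > 0"
  shows "x \<in> K"
proof -
  have "scale (1 / of_nat n) 1 * (of_nat n * x) = x"
    using assms(3) by (simp flip: scale_eq_mult of_nat_scale)
  then show ?thesis using ring_idealD(3)[OF assms(1,2)] by metis
qed

lemma subspace_ring_ideal:
  fixes K :: "'a set"
  assumes "ring_ideal K"
  shows "subspace K"
  unfolding subspace_def using ring_idealD[OF assms] scale_eq_mult by metis

section \<open>Ideals stable under a derivation, and their radicals\<close>

lemma bracket_power: "bracket (x ^ n) w = of_nat n * x ^ (n - 1) * bracket x w"
proof (induction n)
  case 0
  \<comment> \<open>The truncated exponent is harmless because \<open>of_nat 0\<close> vanishes;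
    what remains is \<open>bracket 1 w = 0\<close>.\<close>
  show ?case using leibniz[of 1 1 w] by simp
next
  case (Suc n)
  show ?case
  proof (cases n)
    case (Suc m)
    show ?thesis using Suc.IH by (simp add: leibniz Suc algebra_simps)
  qed simp
qed

text \<open>Coefficients such as 2 appear as ring elements when products are expanded, and inner
  derivations have to kill them.\<close>

lemma bracket_numeral_right: "bracket x (numeral n) = 0"
proof -
  have one: "bracket x 1 = 0" using leibniz_right[of x 1 1] by simp
  have "bracket x (of_nat m) = 0" for m
    by (induction m) (simp_all add: bracket_add_right one)
  from this[of "numeral n"] show ?thesis by simp
qed

text \<open>Bracketing with \<open>w\<close> and then multiplying by \<open>bracket x w\<close>
  trades one factor \<open>x\<close> for two factors \<open>bracket x w\<close>. The multiplication
  also restores the power of \<open>bracket x w\<close> that differentiation lowers, which keeps the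
  unwanted term in \<open>K\<close>.\<close>

lemma stable_ideal_bracket_power:
  assumes K: "ring_ideal K" and stable: "\<And>k. k \<in> K \<Longrightarrow> bracket k w \<in> K"
    and "x ^ n * bracket x w ^ (2 * k) \<in> K"
  shows "bracket x w ^ (2 * (k + n)) \<in> K"
  using assms(3)
proof (induction n arbitrary: k)
  case 0
  then show ?case by simp
next
  case (Suc n)
  let ?y = "bracket x w"
  \<comment> \<open>With \<open>p\<close> general, a case split settles the truncated exponent at
    \<open>p = 0\<close>.\<close>
  have expand: "?y * bracket (x ^ Suc n * ?y ^ p) w =
      of_nat p * bracket ?y w * (x ^ Suc n * ?y ^ p) + of_nat (Suc n) * (x ^ n * ?y ^ Suc (Suc p))" for p
    unfolding leibniz bracket_power by (cases p) (simp_all add: algebra_simps)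
  have "?y * bracket (x ^ Suc n * ?y ^ (2 * k)) w \<in> K"
    using Suc.prems stable ring_idealD(3)[OF K] by blast
  also have "?y * bracket (x ^ Suc n * ?y ^ (2 * k)) w =
      of_nat (2 * k) * bracket ?y w * (x ^ Suc n * ?y ^ (2 * k)) +
      of_nat (Suc n) * (x ^ n * ?y ^ (2 * Suc k))"
    using expand[of "2 * k"] by simp
  finally have "of_nat (Suc n) * (x ^ n * ?y ^ (2 * Suc k)) \<in> K"
    using ring_idealD(3)[OF K Suc.prems] ring_idealD(5)[OF K] by (metis add_diff_cancel_left')
  then have "x ^ n * ?y ^ (2 * Suc k) \<in> K"
    using ring_ideal_divide_of_nat[OF K] by blast
  then show ?case using Suc.IH[of "Suc k"] by simp
qed

text \<open>The classical fact that in characteristic zero the radical of a differential ideal is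
  differential; the trade of factors starts at \<open>k = 0\<close>.\<close>

lemma stable_radical:
  assumes "ring_ideal K" "\<And>k. k \<in> K \<Longrightarrow> bracket k w \<in> K" "x \<in> ring_radical K"
  shows "bracket x w \<in> ring_radical K"
proof -
  obtain n where "x ^ n \<in> K" using assms(3) by (auto simp: ring_radical_def)
  then have "bracket x w ^ (2 * (0 + n)) \<in> K"
    by (intro stable_ideal_bracket_power[OF assms(1,2)]) simp_all
  then show ?thesis by (auto simp: ring_radical_def)
qed

text \<open>Modulo a \<open>U\<close>-stable ideal, \<open>{k, {k, b\<^sup>2}}\<close> is
  \<open>2 {k, b}\<^sup>2\<close>, so the radical is stable under all of \<open>A\<close>.\<close>

lemma stable_ideal_radical:
  assumes K: "ring_ideal K" and stable: "\<And>k a b. k \<in> K \<Longrightarrow> bracket k (bracket a b) \<in> K"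
    and "1 \<notin> K"
  shows "ring_radical K = {0}"
proof -
  let ?R = "ring_radical K"
  have R: "ring_ideal ?R" by (rule ring_ideal_radical[OF K])
  have Rstable: "bracket k (bracket a b) \<in> ?R" if "k \<in> ?R" for k a b
    using stable_radical[OF K stable that] .
  have bracket_R: "bracket k b \<in> ?R" if "k \<in> ?R" for k b
  proof -
    have "bracket k (bracket k (b * b)) =
        of_nat 2 * (b * bracket k (bracket k b)) + of_nat 2 * (bracket k b) ^ 2"
      by (simp add: leibniz_right bracket_add_right bracket_numeral_right power2_eq_square algebra_simps)
    then have "of_nat 2 * (bracket k b) ^ 2 =
        bracket k (bracket k (b * b)) - of_nat 2 * b * bracket k (bracket k b)"
      by (simp add: algebra_simps)
    also have "\<dots> \<in> ?R"
      using Rstable[OF that] ring_idealD(3,5)[OF R] by blast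
    finally have "of_nat 2 * (bracket k b) ^ 2 \<in> ?R" .
    then have "(bracket k b) ^ 2 \<in> ?R" by (rule ring_ideal_divide_of_nat[OF R]) simp
    then show ?thesis by (rule ring_radical_power)
  qed
  have "bracket_span scale bracket ?R UNIV \<subseteq> ?R"
    unfolding bracket_span_def
    by (rule span_minimal[OF _ subspace_ring_ideal[OF R]]) (use bracket_R in blast)
  then have "poisson_ideal scale bracket ?R"
    unfolding poisson_ideal_def using subspace_ring_ideal[OF R] ring_idealD(3)[OF R] by blast
  \<comment> \<open>A radical containing 1 would put 1 into \<open>K\<close>, so simplicity leaves
    only the zero ideal.\<close>
  moreover have "1 \<notin> ?R" using assms(3) by (simp add: one_in_ring_radical_iff)
  ultimately show ?thesis using simple by blast
qed

section \<open>Reducedness and nilpotent inner derivations\<close>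

lemma reduced:
  assumes "x * x = 0"
  shows "x = (0::'a)"
proof -
  \<comment> \<open>The zero ideal is trivially stable and does not contain 1, so the nilradical
    vanishes.\<close>
  have "ring_radical {0} = {0::'a}"
    by (rule stable_ideal_radical) (auto simp: ring_ideal_def)
  moreover have "x ^ 2 \<in> {0}" using assms by (simp add: power2_eq_square)
  then have "x \<in> ring_radical {0}" unfolding ring_radical_def by blast
  ultimately show ?thesis by simp
qed

lemma of_nat_mult_square_eq_0:
  assumes "of_nat n * (x * x) = (0::'a)" "n > 0"
  shows "x = 0"
proof -
  have "ring_ideal {0::'a}" by (simp add: ring_ideal_def)
  moreover have "of_nat n * (x * x) \<in> {0}" using assms(1) by blast
  ultimately have "x * x \<in> {0}" using assms(2) by (rule ring_ideal_divide_of_nat)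
  then have "x * x = 0" by (rule singletonD)
  then show ?thesis by (rule reduced)
qed

text \<open>If a derivation has \<open>d^n = 0\<close>, the Leibniz rule leaves a single term in
  \<open>d^n (x d^(n-2) x) = n (d^(n-1) x)^2\<close>, so reducedness lowers \<open>n\<close> by one.
  The descent runs through \<open>n = 4, 3, 2\<close>; fourth powers cover all later uses.\<close>

lemma ad_nilpotent_central:
  assumes "\<And>x. bracket a (bracket a (bracket a (bracket a x))) = 0"
  shows "bracket a x = 0"
proof -
  define d where "d = bracket a"
  have d_add: "d (x + y) = d x + d y" and d_mult: "d (x * y) = x * d y + d x * y" for x y
    by (simp_all add: d_def bracket_add_right leibniz_right)
  have d4: "d (d (d (d x))) = 0" for x using assms by (simp add: d_def)
  have d0: "d 0 = 0" and d_num: "d (numeral n) = 0" for n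
    by (simp_all add: d_def bracket_numeral_right)
  have "of_nat 4 * (d (d (d x)) * d (d (d x))) = d (d (d (d (x * d (d x)))))" for x
    by (simp add: d_add d_mult d4 d0 d_num algebra_simps)
  then have d3: "d (d (d x)) = 0" for x
    using of_nat_mult_square_eq_0[of 4 "d (d (d x))"] by (simp add: d4)
  have "of_nat 3 * (d (d x) * d (d x)) = d (d (d (x * d x)))" for x
    by (simp add: d_add d_mult d3 d0 d_num algebra_simps)
  then have d2: "d (d x) = 0" for x
    using of_nat_mult_square_eq_0[of 3 "d (d x)"] by (simp add: d3)
  have "of_nat 2 * (d x * d x) = d (d (x * x))" for x
    by (simp add: d_add d_mult d2 d0 d_num algebra_simps)
  then have "d x = 0"
    using of_nat_mult_square_eq_0[of 2 "d x"] by (simp add: d2)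
  then show ?thesis by (simp add: d_def)
qed

text \<open>An ideal of the quotient lifts to such an \<open>I\<close> containing the central part
  of \<open>U\<close>; the first alternative then makes it the zero ideal.\<close>

lemma lie_ideal_of_U:
  assumes I: "subspace I" "I \<subseteq> U" and ideal: "\<And>x y. \<lbrakk>x \<in> I; y \<in> U\<rbrakk> \<Longrightarrow> bracket x y \<in> I"
  shows "I \<subseteq> poisson_center bracket \<or> I = U"
proof -
  define M where "M = {t. \<forall>x. bracket t x \<in> I}"
  define N where "N = {t. \<forall>x. bracket t x \<in> M}"
  define K where "K = {m. \<forall>x. m * x \<in> M}"
  have M: "subspace M"
    using I(1) by (auto simp: M_def subspace_def bracket_add_left bracket_scale_left)
  have M_D: "bracket t x \<in> I" "bracket x t \<in> I" if "t \<in> M" for t x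
    using that subspace_bracket_swap[OF I(1)] by (auto simp: M_def)
  have M_mult: "t * u \<in> M" if "t \<in> M" "u \<in> M" for t u
  proof -
    \<comment> \<open>The mixed terms \<open>bracket t u * x\<close> and
      \<open>x * bracket u t\<close> cancel by anticommutativity.\<close>
    have "bracket (t * u) x = bracket t (u * x) + bracket u (x * t)" for x
      using bracket_anticomm[of u t] by (simp add: leibniz leibniz_right algebra_simps)
    then show ?thesis
      using that subspace_add[OF I(1)] by (simp add: M_def)
  qed
  have M_stable: "bracket t w \<in> M" if "t \<in> M" "w \<in> U" for t w
  proof -
    \<comment> \<open>Of the two Jacobi terms, \<open>bracket (bracket t x) w\<close> is in
      \<open>I\<close> since \<open>I\<close> is an ideal, and
      \<open>bracket t (bracket w x)\<close> since \<open>t \<in> M\<close>.\<close>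
    have "bracket (bracket t w) x \<in> I" for x
      unfolding jacobi_derivation[of t w x]
      using that M_D ideal by (intro subspace_add[OF I(1)]) auto
    then show ?thesis by (simp add: M_def)
  qed
  have II_M: "bracket a b \<in> M" if "a \<in> I" "b \<in> I" for a b
  proof -
    \<comment> \<open>\<open>bracket a x\<close> and \<open>bracket b x\<close> lie in
      \<open>U\<close>, so both Jacobi terms pair \<open>I\<close> with \<open>U\<close>.\<close>
    have "bracket (bracket a b) x \<in> I" for x
      unfolding jacobi_derivation[of a b x]
      using that ideal by (auto intro!: subspace_add[OF I(1)] intro: subspace_bracket_swap[OF I(1)])
    then show ?thesis by (simp add: M_def)
  qed
  have K: "ring_ideal K"
    using M by (auto simp: ring_ideal_def K_def subspace_0 subspace_add distrib_right mult.assoc)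
      (metis mult.left_commute)
  have K_stable: "bracket k (bracket a b) \<in> K" if "k \<in> K" for k a b
  proof -
    \<comment> \<open>Both \<open>k * y\<close> and \<open>k * bracket y (bracket a b)\<close> lie
      in \<open>M\<close>, and the former stays there when bracketed with \<open>U\<close>.\<close>
    have "bracket k (bracket a b) * y = bracket (k * y) (bracket a b) - k * bracket y (bracket a b)" for y
      by (simp add: leibniz)
    then show ?thesis
      using that M_stable subspace_diff[OF M] by (auto simp: K_def)
  qed
  show ?thesis
  proof (cases "1 \<in> K")
    case True
    then have "bracket x y \<in> I" for x y using M_D by (simp add: K_def)
    then show ?thesis using U_minimal[OF I(1)] I(2) by blast
  next
    case False
    then have K0: "K \<subseteq> {0}"
      using stable_ideal_radical[OF K K_stable] ring_radical_superset by blast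
    have NM: "bracket t u = 0" if "t \<in> N" "u \<in> M" for t u
    proof -
      have "bracket t u * x = bracket t (u * x) - u * bracket t x" for x
        by (simp add: leibniz_right)
      \<comment> \<open>The first term is in \<open>M\<close> as \<open>t \<in> N\<close>, the
        second because \<open>bracket t x \<in> M\<close> and \<open>M\<close> is closed under
        products.\<close>
      then have "bracket t u \<in> K"
        using that M_mult subspace_diff[OF M] by (simp add: K_def N_def)
      then show ?thesis using K0 by blast
    qed
    have central: "bracket t x = 0" if "t \<in> N" "t \<in> M" for t x
    proof (rule ad_nilpotent_central)
      have "bracket t y \<in> M" for y using that(1) by (simp add: N_def)
      then have "bracket t (bracket t y) = 0" for y using NM that(1) by blast
      then show "bracket t (bracket t (bracket t (bracket t x))) = 0" for x by simp
    qed
    have MI_N: "bracket p q \<in> N" if "p \<in> M" "q \<in> I" for p q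
    proof -
      \<comment> \<open>\<open>bracket p x\<close> is in \<open>I\<close>, so one Jacobi term is in
        \<open>{I, I}\<close>; the other is in \<open>M\<close> by stability under
        \<open>U\<close>.\<close>
      have "bracket (bracket p q) x \<in> M" for x
        unfolding jacobi_derivation[of p q x]
        using that II_M M_D M_stable by (intro subspace_add[OF M]) auto
      then show ?thesis by (simp add: N_def)
    qed
    have MI: "bracket (bracket p q) x = 0" if "p \<in> M" "q \<in> I" for p q x
      using central[OF MI_N[OF that] M_stable] that I(2) by blast
    have M_central: "bracket m x = 0" if "m \<in> M" for m x
    proof (rule ad_nilpotent_central)
      fix x
      \<comment> \<open>Since \<open>bracket m x \<in> I\<close>, the element
        \<open>bracket m (bracket m x)\<close> is central by \<open>MI\<close>.\<close>
      have "bracket (bracket m (bracket m x)) m = 0" using MI M_D that by blast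
      then have "bracket m (bracket m (bracket m x)) = 0" by (rule bracket_eq_0_swap)
      then show "bracket m (bracket m (bracket m (bracket m x))) = 0" by simp
    qed
    have "bracket a x = 0" if "a \<in> I" for a x
    proof (rule ad_nilpotent_central)
      fix x
      \<comment> \<open>\<open>bracket a (bracket a x)\<close> is in \<open>I\<close>, so a third
        bracket with \<open>a\<close> lands in \<open>{I, I}\<close>, hence in the now central
        \<open>M\<close>, and the fourth vanishes.\<close>
      have "bracket a (bracket a (bracket a x)) \<in> M"
        using II_M ideal that by blast
      then show "bracket a (bracket a (bracket a (bracket a x))) = 0"
        by (rule bracket_eq_0_swap[OF M_central])
    qed
    then show ?thesis by (auto simp: poisson_center_def)
  qed
qed

text \<open>Bracketing three times with an element of \<open>U\<close> gives zero, so
  \<open>U\<close> is central; then bracketing twice with any \<open>a\<close> gives zero. This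
  excludes an abelian quotient when the bracket is nonzero.\<close>

lemma bracket_eq_0_if_U_nilpotent:
  assumes "\<And>x y. \<lbrakk>x \<in> U; y \<in> U\<rbrakk> \<Longrightarrow> bracket x y \<in> poisson_center bracket"
  shows "bracket a b = 0"
proof -
  have "bracket u x = 0" if "u \<in> U" for u x
  proof (rule ad_nilpotent_central)
    fix x
    have "bracket (bracket u (bracket u x)) u = 0"
      using assms[OF that bracket_in_U] by (simp add: poisson_center_def)
    then have "bracket u (bracket u (bracket u x)) = 0" by (rule bracket_eq_0_swap)
    then show "bracket u (bracket u (bracket u (bracket u x))) = 0" by simp
  qed
  then have "bracket a (bracket a x) = 0" for x
    by (rule bracket_eq_0_swap) blast
  then show ?thesis using ad_nilpotent_central[of a b] by simp
qed

end

section \<open>Quotients of Lie algebras\<close>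

lemma (in vector_space) coset_eq_iff:
  assumes "subspace N"
  shows "(+) x ` N = (+) y ` N \<longleftrightarrow> x - y \<in> N"
proof
  assume eq: "(+) x ` N = (+) y ` N"
  have "x + 0 \<in> (+) x ` N" by (rule imageI[OF subspace_0[OF assms]])
  then have "x + 0 \<in> (+) y ` N" unfolding eq .
  then show "x - y \<in> N" by auto
next
  have sub: "(+) x ` N \<subseteq> (+) y ` N" if "x - y \<in> N" for x y
  proof
    fix z assume "z \<in> (+) x ` N"
    then obtain n where n: "n \<in> N" "z = x + n" by blast
    then have "z = y + ((x - y) + n)" by simp
    moreover have "(x - y) + n \<in> N" by (rule subspace_add[OF assms that n(1)])
    ultimately show "z \<in> (+) y ` N" by (rule image_eqI)
  qed
  assume "x - y \<in> N"
  moreover from this have "y - x \<in> N" using subspace_neg[OF assms, of "x - y"] by simp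
  ultimately show "(+) x ` N = (+) y ` N" by (intro subset_antisym sub)
qed

text \<open>All sets in the union are the same coset and the index set is nonempty. The left side
  has the shape of the operations in \<open>lie_quotient\<close>.\<close>

lemma (in vector_space) coset_UN:
  assumes N: "subspace N" and f: "\<And>n. n \<in> N \<Longrightarrow> f (x + n) - f x \<in> N"
  shows "(\<Union>u\<in>(+) x ` N. (+) (f u) ` N) = (+) (f x) ` N"
proof -
  have "(+) (f u) ` N = (+) (f x) ` N" if "u \<in> (+) x ` N" for u
    using that f by (auto simp only: coset_eq_iff[OF N])
  moreover have "(+) x ` N \<noteq> {}" using subspace_0[OF N] by blast
  ultimately show ?thesis by simp
qed

lemma (in vector_space) coset_UN2:
  assumes N: "subspace N"
    and f: "\<And>n m. \<lbrakk>n \<in> N; m \<in> N\<rbrakk> \<Longrightarrow> f (x + n) (y + m) - f x y \<in> N"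
  shows "(\<Union>u\<in>(+) x ` N. \<Union>v\<in>(+) y ` N. (+) (f u v) ` N) = (+) (f x y) ` N"
proof -
  have "(+) (f u v) ` N = (+) (f x y) ` N" if "u \<in> (+) x ` N" "v \<in> (+) y ` N" for u v
    using that f by (auto simp only: coset_eq_iff[OF N])
  moreover have "(+) x ` N \<noteq> {}" "(+) y ` N \<noteq> {}" using subspace_0[OF N] by blast+
  ultimately show ?thesis by simp
qed

text \<open>Addition and scaling come from the ambient space, but the bracket is constrained only on
  \<open>S\<close>; hence \<open>brk_Q\<close>, unlike \<open>add_Q\<close>, asks for
  representatives in \<open>S\<close>.\<close>

locale lie_subspace_quotient = vector_space scale
  for scale :: "'f::field \<Rightarrow> 'a::ab_group_add \<Rightarrow> 'a" +
  fixes bracket :: "'a \<Rightarrow> 'a \<Rightarrow> 'a" and S N :: "'a set"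
  assumes lie: "lie_algebra (lie_on scale bracket S)"
    and ideal: "lie_ideal (lie_on scale bracket S) N"
begin

abbreviation "Q \<equiv> lie_quotient (lie_on scale bracket S) N"
abbreviation "coset x \<equiv> (+) x ` N"

lemmas bracket_simps =
  lie_algebra.brk_add_left[OF lie, simplified lie_on_def lie_struct.simps]
  lie_algebra.brk_add_right[OF lie, simplified lie_on_def lie_struct.simps]
  lie_algebra.brk_smult_left[OF lie, simplified lie_on_def lie_struct.simps]
  lie_algebra.brk_smult_right[OF lie, simplified lie_on_def lie_struct.simps]
  lie_algebra.brk_alternating[OF lie, simplified lie_on_def lie_struct.simps]
  lie_algebra.jacobi[OF lie, simplified lie_on_def lie_struct.simps]
  lie_algebra.brk_closed[OF lie, simplified lie_on_def lie_struct.simps]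

lemma subspace_S: "subspace S"
  using lie_algebra.zero_closed[OF lie] lie_algebra.add_closed[OF lie] lie_algebra.smult_closed[OF lie]
  by (simp add: lie_on_def subspace_def)

lemma subspace_N: "subspace N" and N_S: "N \<subseteq> S"
  and N_bracket_left: "\<lbrakk>x \<in> N; y \<in> S\<rbrakk> \<Longrightarrow> bracket x y \<in> N"
  using ideal by (simp_all add: lie_on_def subspace_def lie_ideal_def)

text \<open>\<open>lie_ideal\<close> speaks only of ideal elements on the left; alternation at
  \<open>x + y\<close> gives the other side.\<close>

lemma N_bracket_right:
  assumes "y \<in> N" "x \<in> S"
  shows "bracket x y \<in> N"
proof -
  have yS: "y \<in> S" using assms(1) N_S by blast
  then have xyS: "x + y \<in> S" using assms(2) subspace_add[OF subspace_S] by blast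
  have "bracket x y + bracket y x = bracket (x + y) (x + y)"
    unfolding bracket_simps(1)[OF assms(2) yS xyS] bracket_simps(2)[OF assms(2) assms(2) yS]
      bracket_simps(2)[OF yS assms(2) yS]
    using assms(2) yS by (simp add: bracket_simps(5))
  also have "\<dots> = 0" by (rule bracket_simps(5)[OF xyS])
  finally have "bracket x y = - bracket y x" by (rule eq_neg_iff_add_eq_0[THEN iffD2])
  then show ?thesis using subspace_neg[OF subspace_N N_bracket_left[OF assms]] by simp
qed

lemma coset_eq: "coset x = coset y \<longleftrightarrow> x - y \<in> N"
  by (rule coset_eq_iff[OF subspace_N])

section \<open>Operations on cosets, and ideals of the quotient\<close>

lemma carrier_Q: "carrier Q = {coset x | x. x \<in> S}"
  and zero_Q: "zero Q = coset 0"
  by (simp_all add: lie_quotient_def lie_on_def)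

lemma add_Q: "add Q (coset x) (coset y) = coset (x + y)"
proof -
  have "(\<Union>u\<in>coset x. \<Union>v\<in>coset y. coset (u + v)) = coset (x + y)"
    by (rule coset_UN2[OF subspace_N]) (simp add: add.assoc add.left_commute subspace_add[OF subspace_N] algebra_simps)
  then show ?thesis by (simp only: lie_quotient_def lie_on_def lie_struct.simps)
qed

lemma smult_Q: "smult Q c (coset x) = coset (scale c x)"
proof -
  have "(\<Union>u\<in>coset x. coset (scale c u)) = coset (scale c x)"
    by (rule coset_UN[OF subspace_N]) (simp add: scale_right_distrib subspace_scale[OF subspace_N])
  then show ?thesis by (simp only: lie_quotient_def lie_on_def lie_struct.simps)
qed

lemma brk_Q:
  assumes "x \<in> S" "y \<in> S"
  shows "brk Q (coset x) (coset y) = coset (bracket x y)"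
proof -
  have "(\<Union>u\<in>coset x. \<Union>v\<in>coset y. coset (bracket u v)) = coset (bracket x y)"
  proof (rule coset_UN2[OF subspace_N])
    fix n m assume nm: "n \<in> N" "m \<in> N"
    then have S: "n \<in> S" "m \<in> S" "y + m \<in> S" using N_S assms subspace_add[OF subspace_S] by blast+
    then have "bracket (x + n) (y + m) - bracket x y = bracket x m + bracket n (y + m)"
      using assms by (simp add: bracket_simps)
    also have "\<dots> \<in> N"
      using nm S assms by (intro subspace_add[OF subspace_N] N_bracket_left N_bracket_right)
    finally show "bracket (x + n) (y + m) - bracket x y \<in> N" .
  qed
  then show ?thesis by (simp only: lie_quotient_def lie_on_def lie_struct.simps)
qed

lemmas Q_simps = zero_Q add_Q smult_Q brk_Q

lemma Q_cases:
  assumes "X \<in> carrier Q"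
  obtains x where "x \<in> S" "X = coset x"
  using assms carrier_Q by auto

lemma coset_in_Q: "x \<in> S \<Longrightarrow> coset x \<in> carrier Q"
  using carrier_Q by auto

lemmas S_closed = subspace_0[OF subspace_S] subspace_add[OF subspace_S]
  subspace_scale[OF subspace_S] subspace_neg[OF subspace_S] bracket_simps(7)

lemma lie_algebra_Q: "lie_algebra Q"
proof
  fix x assume "x \<in> carrier Q"
  then obtain a where a: "a \<in> S" "x = coset a" by (rule Q_cases)
  then have "add Q x (coset (- a)) = zero Q" by (simp only: Q_simps) simp
  then show "\<exists>y\<in>carrier Q. add Q x y = zero Q"
    using coset_in_Q S_closed(4) a(1) by blast
qed ((elim Q_cases)?; simp only: Q_simps S_closed coset_in_Q bracket_simps scale_right_distrib
    scale_left_distrib scale_scale scale_one add.assoc add_0_left; simp add: add.commute)+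

text \<open>Correspondence of ideals: the preimage \<open>I\<close> of an ideal \<open>J\<close> of
  \<open>Q\<close> contains \<open>N\<close>, and \<open>J\<close> is recovered as the image of
  \<open>I\<close>.\<close>

lemma simple_Q:
  assumes "\<And>I. \<lbrakk>subspace I; I \<subseteq> S; N \<subseteq> I; \<And>x y. \<lbrakk>x \<in> I; y \<in> S\<rbrakk> \<Longrightarrow> bracket x y \<in> I\<rbrakk>
    \<Longrightarrow> I = N \<or> I = S"
  shows "simple_lie_algebra Q"
  unfolding simple_lie_algebra_def
proof (intro conjI allI impI)
  show "lie_algebra Q" by (rule lie_algebra_Q)
next
  fix J assume J: "lie_ideal Q J"
  define I where "I = {x \<in> S. coset x \<in> J}"
  have J_sub: "J \<subseteq> carrier Q" and J0: "coset 0 \<in> J"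
    and J_add: "\<And>x y. \<lbrakk>coset x \<in> J; coset y \<in> J\<rbrakk> \<Longrightarrow> coset (x + y) \<in> J"
    and J_scale: "\<And>c x. coset x \<in> J \<Longrightarrow> coset (scale c x) \<in> J"
    and J_brk: "\<And>X Y. \<lbrakk>X \<in> J; Y \<in> carrier Q\<rbrakk> \<Longrightarrow> brk Q X Y \<in> J"
    using J unfolding lie_ideal_def by (auto simp only: Q_simps simp flip: add_Q smult_Q)
  have J_eq: "J = coset ` I"
    using J_sub by (auto simp: I_def carrier_Q)
  have "I = N \<or> I = S"
  proof (rule assms)
    show "subspace I"
      unfolding subspace_def I_def using J0 J_add J_scale S_closed by blast
    show "N \<subseteq> I"
    proof
      fix n assume n: "n \<in> N"
      then have "coset n = coset 0" by (simp only: coset_eq diff_0_right)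
      then show "n \<in> I" using J0 N_S n unfolding I_def by auto
    qed
    show "bracket x y \<in> I" if "x \<in> I" "y \<in> S" for x y
      using that J_brk[of "coset x" "coset y"] S_closed(5) coset_in_Q by (simp add: I_def brk_Q)
  qed (auto simp: I_def)
  then show "J = {zero Q} \<or> J = carrier Q"
  proof
    assume IN: "I = N"
    have "coset n = coset 0" if "n \<in> N" for n using that by (simp only: coset_eq diff_0_right)
    then have "coset ` N = {coset 0}" using subspace_0[OF subspace_N] by blast
    then show ?thesis unfolding J_eq IN zero_Q by blast
  next
    assume IS: "I = S"
    show ?thesis unfolding J_eq IS carrier_Q by blast
  qed
qed

lemma lie_abelian_Q:
  assumes "lie_abelian Q" "x \<in> S" "y \<in> S"
  shows "bracket x y \<in> N"
proof -
  have "coset (bracket x y) = coset 0"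
    using assms coset_in_Q by (simp only: lie_abelian_def flip: brk_Q zero_Q)
  then show ?thesis by (simp only: coset_eq diff_0_right)
qed

end

text \<open>\<open>simple_lie_algebra\<close> by itself admits abelian algebras, so the second
  conjunct rules them out for a nonzero bracket. For the zero bracket, \<open>U\<close> and the
  quotient are zero.\<close>

theorem theorem1:
  fixes scale :: "'f::field_char_0 \<Rightarrow> 'a::comm_ring_1 \<Rightarrow> 'a"
    and bracket :: "'a \<Rightarrow> 'a \<Rightarrow> 'a"
  assumes "simple_poisson_algebra scale bracket"
  shows "let U = bracket_span scale bracket UNIV UNIV;
             Z = poisson_center bracket;
             Q = lie_quotient (lie_on scale bracket U) (U \<inter> Z)
         in simple_lie_algebra Q \<and> ((\<exists>a b. bracket a b \<noteq> 0) \<longrightarrow> \<not> lie_abelian Q)"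
proof -
  interpret P: poisson_algebra scale bracket
    using assms by (simp add: simple_poisson_algebra_def)
  interpret P: unital_simple_poisson_algebra scale bracket
    by unfold_locales (use assms in \<open>simp add: simple_poisson_algebra_def\<close>)
  define Z where "Z = poisson_center bracket"
  have sub: "P.subspace (P.U \<inter> Z)"
    using P.subspace_U
    by (auto simp: P.subspace_def Z_def poisson_center_def P.bracket_add_left P.bracket_scale_left)
  interpret L: lie_subspace_quotient scale bracket P.U "P.U \<inter> Z"
  proof (intro lie_subspace_quotient.intro lie_subspace_quotient_axioms.intro)
    show "vector_space scale" by (rule P.vector_space_axioms)
    show "lie_algebra (lie_on scale bracket P.U)"
      using P.subspace_U by (rule P.lie_algebra_on) simp
    show "lie_ideal (lie_on scale bracket P.U) (P.U \<inter> Z)"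
      using sub by (auto simp: lie_ideal_def lie_on_def P.subspace_def Z_def poisson_center_def)
  qed
  have "simple_lie_algebra L.Q"
  proof (rule L.simple_Q)
    fix I assume "P.subspace I" "I \<subseteq> P.U" "P.U \<inter> Z \<subseteq> I"
      and "\<And>x y. \<lbrakk>x \<in> I; y \<in> P.U\<rbrakk> \<Longrightarrow> bracket x y \<in> I"
    \<comment> \<open>A central \<open>I\<close> inside \<open>U\<close> equals
      \<open>U \<inter> Z\<close>, since it also contains that set.\<close>
    then show "I = P.U \<inter> Z \<or> I = P.U"
      using P.lie_ideal_of_U[of I] unfolding Z_def by blast
  qed
  moreover have "\<not> lie_abelian L.Q" if "bracket a b \<noteq> 0" for a b
    using that L.lie_abelian_Q P.bracket_eq_0_if_U_nilpotent[of a b] unfolding Z_def by blast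
  ultimately show ?thesis
    unfolding Let_def Z_def by blast
qed

end
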